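(* Let $A$ be a C*-factor of von Neumann type I. Then there exists a cardinal number $n$ such that $A$ is a C*-algebra of type $I_n$.
   Context: A C*-algebra $A$ is a C*-factor if it does not have nonzero proper two-sided ideals $I,J$ with $IJ=\{ab:a\in I,b\in J\}=\{0\}$. For $S\subseteq A$, $\mathrm{Ann}(S)=\{a\in A: as+sa=0 \text{ for all } s\in S\}$; the set of annihilators is $\mathcal{P}=\{\mathrm{Ann}(\mathrm{Ann}(S)): S\subseteq A_+\}$, ordered by inclusion (a complete lattice; suprema are taken in $\mathcal{P}$). For $V\subseteq A$ let ${}^dV=\{a\in A: xay+yax=0 \ \forall x,y\in V\}$. $V\in\mathcal{P}$ is central if ${}^d(\mathrm{Ann}(\mathrm{Ann}(S)))\cap{}^d(\mathrm{Ann}(S))=\{0\}$ where $S\subseteq A_+$, $V=\mathrm{Ann}(\mathrm{Ann}(S))$. The central support $c(V)$ of $V\in\mathcal{P}$ is the greatest lower bound in $\mathcal{P}$ of the central annihilators containing $V$. $V\in\mathcal{P}$ is Abelian if it is commutative. $A$ is of von Neumann type I if there is an Abelian annihilator $V$ with $c(V)=A$. Annihilators $V,W$ are orthogonal if $\{vw:v\in V,w\in W\}=\{0\}$. For a cardinal $n$, $A$ is a C*-algebra of type $I_n$ if there is a family $\{P_i\}_{i\in\Xi}$ with $|\Xi|=n$ of pairwise orthogonal Abelian annihilators with central support $A$ and with $\sup_i P_i=A$ in $\mathcal{P}$. *)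

theory Defs
  imports Complex_Main
begin

locale cstar_algebra =
  fixes cscale :: "complex \<Rightarrow> 'a::{real_normed_algebra, banach} \<Rightarrow> 'a"
    and star :: "'a \<Rightarrow> 'a"
  assumes cscale_of_real: "cscale (of_real r) x = scaleR r x"
    and cscale_add_right: "cscale c (x + y) = cscale c x + cscale c y"
    and cscale_add_left: "cscale (c + d) x = cscale c x + cscale d x"
    and cscale_cscale: "cscale c (cscale d x) = cscale (c * d) x"
    and cscale_one: "cscale 1 x = x"
    and cscale_mult_left: "cscale c (x * y) = cscale c x * y"
    and cscale_mult_right: "cscale c (x * y) = x * cscale c y"
    and norm_cscale: "norm (cscale c x) = cmod c * norm x"
    and star_star: "star (star x) = x"
    and star_add: "star (x + y) = star x + star y"
    and star_cscale: "star (cscale c x) = cscale (cnj c) (star x)"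
    and star_mult: "star (x * y) = star y * star x"
    and cstar_identity: "norm (star x * x) = (norm x)\<^sup>2"

definition positive_part :: "('a::ring \<Rightarrow> 'a) \<Rightarrow> 'a set" where
  "positive_part star = {star x * x | x. True}"

definition two_sided_ideal :: "(complex \<Rightarrow> 'a::ring \<Rightarrow> 'a) \<Rightarrow> 'a set \<Rightarrow> bool" where
  "two_sided_ideal cscale I \<longleftrightarrow>
     0 \<in> I \<and> (\<forall>x\<in>I. \<forall>y\<in>I. x + y \<in> I) \<and> (\<forall>c. \<forall>x\<in>I. cscale c x \<in> I) \<and>
     (\<forall>a. \<forall>x\<in>I. a * x \<in> I \<and> x * a \<in> I)"

definition cstar_factor :: "(complex \<Rightarrow> 'a::ring \<Rightarrow> 'a) \<Rightarrow> bool" where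
  "cstar_factor cscale \<longleftrightarrow>
     \<not> (\<exists>I J. two_sided_ideal cscale I \<and> two_sided_ideal cscale J \<and>
             I \<noteq> {0} \<and> I \<noteq> UNIV \<and> J \<noteq> {0} \<and> J \<noteq> UNIV \<and>
             {a * b | a b. a \<in> I \<and> b \<in> J} = {0})"

definition Ann :: "'a::ring set \<Rightarrow> 'a set" where
  "Ann S = {a. \<forall>s\<in>S. a * s + s * a = 0}"

definition annihilators :: "('a::ring \<Rightarrow> 'a) \<Rightarrow> 'a set set" where
  "annihilators star = {Ann (Ann S) | S. S \<subseteq> positive_part star}"

definition dual_set :: "'a::ring set \<Rightarrow> 'a set" where
  "dual_set V = {a. \<forall>x\<in>V. \<forall>y\<in>V. x * a * y + y * a * x = 0}"

definition central_ann :: "('a::ring \<Rightarrow> 'a) \<Rightarrow> 'a set \<Rightarrow> bool" where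
  "central_ann star V \<longleftrightarrow>
     (\<exists>S. S \<subseteq> positive_part star \<and> V = Ann (Ann S) \<and>
          dual_set (Ann (Ann S)) \<inter> dual_set (Ann S) = {0})"

definition is_glb_in :: "'a set set \<Rightarrow> 'a set set \<Rightarrow> 'a set \<Rightarrow> bool" where
  "is_glb_in P X m \<longleftrightarrow> m \<in> P \<and> (\<forall>x\<in>X. m \<subseteq> x) \<and>
     (\<forall>m'\<in>P. (\<forall>x\<in>X. m' \<subseteq> x) \<longrightarrow> m' \<subseteq> m)"

definition is_lub_in :: "'a set set \<Rightarrow> 'a set set \<Rightarrow> 'a set \<Rightarrow> bool" where
  "is_lub_in P X m \<longleftrightarrow> m \<in> P \<and> (\<forall>x\<in>X. x \<subseteq> m) \<and>
     (\<forall>m'\<in>P. (\<forall>x\<in>X. x \<subseteq> m') \<longrightarrow> m \<subseteq> m')"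

definition ann_inf :: "('a::ring \<Rightarrow> 'a) \<Rightarrow> 'a set set \<Rightarrow> 'a set" where
  "ann_inf star X = (THE m. is_glb_in (annihilators star) X m)"

definition ann_sup :: "('a::ring \<Rightarrow> 'a) \<Rightarrow> 'a set set \<Rightarrow> 'a set" where
  "ann_sup star X = (THE m. is_lub_in (annihilators star) X m)"

definition central_support :: "('a::ring \<Rightarrow> 'a) \<Rightarrow> 'a set \<Rightarrow> 'a set" where
  "central_support star V =
     ann_inf star {W \<in> annihilators star. central_ann star W \<and> V \<subseteq> W}"

definition abelian_set :: "'a::ring set \<Rightarrow> bool" where
  "abelian_set V \<longleftrightarrow> (\<forall>x\<in>V. \<forall>y\<in>V. x * y = y * x)"

definition abelian_ann :: "('a::ring \<Rightarrow> 'a) \<Rightarrow> 'a set \<Rightarrow> bool" where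
  "abelian_ann star V \<longleftrightarrow> V \<in> annihilators star \<and> abelian_set V"

definition vN_type_I :: "('a::ring \<Rightarrow> 'a) \<Rightarrow> bool" where
  "vN_type_I star \<longleftrightarrow> (\<exists>V. abelian_ann star V \<and> central_support star V = UNIV)"

definition orthogonal_sets :: "'a::ring set \<Rightarrow> 'a set \<Rightarrow> bool" where
  "orthogonal_sets V W \<longleftrightarrow> (\<forall>v\<in>V. \<forall>w\<in>W. v * w = 0)"

text \<open>A is of type I_n, with n the cardinality of the index set Xi.\<close>
definition type_I_family :: "('a::ring \<Rightarrow> 'a) \<Rightarrow> 'i set \<Rightarrow> ('i \<Rightarrow> 'a set) \<Rightarrow> bool" where
  "type_I_family star Xi P \<longleftrightarrow>
     (\<forall>i\<in>Xi. abelian_ann star (P i) \<and> central_support star (P i) = UNIV) \<and>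
     (\<forall>i\<in>Xi. \<forall>j\<in>Xi. i \<noteq> j \<longrightarrow> orthogonal_sets (P i) (P j)) \<and>
     ann_sup star (P ` Xi) = UNIV"

end

theory Submission
  imports Defs
begin

text \<open>
  The annihilators are Jordan annihilators of positive sets; the analytic core is that
  \<open>a s + s a = 0\<close> with \<open>s = x\<^sup>* x\<close> forces \<open>a s = s a = 0\<close>. Indeed \<open>a\<close> then commutes with \<open>s\<^sup>2\<close>,
  hence with \<open>\<bar>s\<bar>\<close>, and \<open>\<bar>s\<bar> = s\<close> by the Kelley-Vaught theorem. So annihilators are the
  star-closed sets equal to their double two-sided annihilator.

  In a factor, \<open>w A v = 0\<close> implies \<open>w = 0\<close> or \<open>v = 0\<close>; hence the central annihilators are trivial
  and every nonzero annihilator has central support \<open>A\<close>. If \<open>V\<close> is an Abelian annihilator and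
  \<open>x \<in> V A\<close>, then \<open>x A x\<^sup>* \<subseteq> V\<close> is commutative, which for \<open>t = x\<^sup>* x\<close> reads
  \<open>t p t q t = t q t p t\<close>; cancelling \<open>t\<close> shows that the annihilator generated by \<open>t\<close> is Abelian.
  This allows any orthogonal family of Abelian annihilators with nonzero complement to be
  enlarged, and a maximal one has supremum \<open>A\<close>.
\<close>

context cstar_algebra
begin

section \<open>Elementary consequences of the C*-algebra axioms\<close>

lemma star_zero [simp]: "star 0 = 0"
  using star_add[of 0 0] by simp

lemma star_minus [simp]: "star (- x) = - star x"
  using star_add[of x "- x"] by (simp add: eq_neg_iff_add_eq_0 add.commute)

lemma star_diff: "star (x - y) = star x - star y"
  using star_add[of x "- y"] by simp

lemma star_scaleR: "star (r *\<^sub>R x) = r *\<^sub>R star x"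
  using star_cscale[of "of_real r" x] by (simp add: cscale_of_real)

lemma cscale_minus: "cscale c (- x) = - cscale c x"
proof -
  have "cscale c 0 = 0"
    using cscale_add_right[of c 0 0] by simp
  then show ?thesis
    using cscale_add_right[of c x "- x"] by (simp add: eq_neg_iff_add_eq_0 add.commute)
qed

lemma cscale_diff: "cscale c (x - y) = cscale c x - cscale c y"
  using cscale_add_right[of c x "- y"] by (simp add: cscale_minus)

lemma cscale_uminus_left: "cscale (- c) x = - cscale c x"
proof -
  have "cscale 0 x = 0"
    using cscale_add_left[of 0 0 x] by simp
  then show ?thesis
    using cscale_add_left[of c "- c" x] by (simp add: eq_neg_iff_add_eq_0 add.commute)
qed

lemma cscale_ii_ii: "cscale \<i> (cscale \<i> x) = - x"
  by (simp add: cscale_cscale cscale_uminus_left cscale_one)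

lemma star_cscale_ii: "star (cscale \<i> x) = - cscale \<i> (star x)"
  by (simp add: star_cscale cscale_uminus_left)

lemma star_mult_self_eq_0: "star x * x = 0 \<Longrightarrow> x = 0"
  using cstar_identity[of x] by simp

lemma mult_star_self_eq_0: "x * star x = 0 \<Longrightarrow> x = 0"
  using star_mult_self_eq_0[of "star x"] star_star[of x] by (metis star_zero)

lemma star_mult_eq_0: "a * b = 0 \<Longrightarrow> star b * star a = 0"
  by (metis star_mult star_zero)

lemma mult_star_mult_self_eq_0:
  assumes "a * (star y * y) = 0"
  shows "a * star y = 0"
proof (rule mult_star_self_eq_0)
  have "a * star y * star (a * star y) = a * (star y * y) * star a"
    by (simp add: star_mult star_star mult.assoc)
  then show "a * star y * star (a * star y) = 0"
    using assms by simp
qed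

lemma norm_star [simp]: "norm (star x) = norm x"
proof -
  have le: "norm y \<le> norm (star y)" for y
  proof (cases "y = 0")
    case False
    have "norm y * norm y \<le> norm (star y) * norm y"
      using norm_mult_ineq[of "star y" y] by (simp add: cstar_identity power2_eq_square)
    then show ?thesis using False by simp
  qed simp
  show ?thesis
    using le[of x] le[of "star x"] by (simp add: star_star)
qed

lemma tendsto_star: "(f \<longlongrightarrow> l) F \<Longrightarrow> ((\<lambda>n. star (f n)) \<longlongrightarrow> star l) F"
  by (simp add: tendsto_iff dist_norm star_diff[symmetric])

section \<open>Positivity read off from left multiplication\<close>

text \<open>The hypothesis at \<open>c = star a\<close> and the C*-identity give the bound, so
  estimates on left multiplication operators transfer to norms.\<close>

lemma norm_le_of_left_mult:
  fixes a :: 'a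
  assumes "0 \<le> K" "\<And>c. norm (a * c) \<le> K * norm c"
  shows "norm a \<le> K"
proof (cases "a = 0")
  case False
  have "norm a * norm a \<le> K * norm a"
    using assms(2)[of "star a"] cstar_identity[of "star a"]
    by (simp add: star_star power2_eq_square)
  then show ?thesis using False by simp
qed (use assms in simp)

text \<open>This is \<open>\<parallel>1 - a\<parallel> \<le> 1\<close> in the unitization, which acts on \<^typ>\<open>'a\<close> by left multiplication.\<close>
definition contr :: "'a \<Rightarrow> bool" where
  "contr a \<longleftrightarrow> (\<forall>c. norm (c - a * c) \<le> norm c)"

text \<open>For self-adjoint \<open>a\<close> the second condition places the spectrum in the
  interval from 0 to 2/k: this is positivity, stated without spectra or a unit.\<close>

definition pos :: "'a \<Rightarrow> bool" where
  "pos a \<longleftrightarrow> star a = a \<and> (\<exists>k>0. contr (k *\<^sub>R a))"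

text \<open>1 - l a is a convex combination of 1 and 1 - k a, with weight l/k on the latter.\<close>

lemma contr_antimono:
  assumes "contr (k *\<^sub>R a)" "0 \<le> l" "l \<le> k"
  shows "contr (l *\<^sub>R a)"
proof (cases "k = 0")
  case False
  then have k: "k > 0" using assms by simp
  define \<theta> where "\<theta> = l / k"
  have \<theta>: "0 \<le> \<theta>" "\<theta> \<le> 1" "l = \<theta> * k"
    using assms k by (auto simp: \<theta>_def)
  have "norm (c - (l *\<^sub>R a) * c) \<le> norm c" for c
  proof -
    have "c - (l *\<^sub>R a) * c = (1 - \<theta>) *\<^sub>R c + \<theta> *\<^sub>R (c - (k *\<^sub>R a) * c)"
      by (simp add: \<theta>(3) algebra_simps)
    then have "norm (c - (l *\<^sub>R a) * c) \<le> (1 - \<theta>) * norm c + \<theta> * norm (c - (k *\<^sub>R a) * c)"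
      using \<theta> norm_triangle_ineq[of "(1 - \<theta>) *\<^sub>R c" "\<theta> *\<^sub>R (c - (k *\<^sub>R a) * c)"] by simp
    also have "\<dots> \<le> (1 - \<theta>) * norm c + \<theta> * norm c"
      using assms(1) \<theta> by (intro add_mono mult_left_mono) (auto simp: contr_def)
    finally show ?thesis by (simp add: algebra_simps)
  qed
  then show ?thesis by (simp add: contr_def)
qed (use assms in auto)

lemma contr_half_add:
  assumes "contr a" "contr b"
  shows "contr ((1/2) *\<^sub>R (a + b))"
proof -
  have "norm (c - ((1/2) *\<^sub>R (a + b)) * c) \<le> norm c" for c
  proof -
    have "c - ((1/2) *\<^sub>R (a + b)) * c = (1/2) *\<^sub>R ((c - a * c) + (c - b * c))"
      by (simp add: algebra_simps flip: scaleR_add_left)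
    then have "norm (c - ((1/2) *\<^sub>R (a + b)) * c) = norm ((c - a * c) + (c - b * c)) / 2"
      by simp
    also have "\<dots> \<le> (norm c + norm c) / 2"
      using assms by (intro divide_right_mono norm_triangle_mono) (auto simp: contr_def)
    finally show ?thesis by simp
  qed
  then show ?thesis by (simp add: contr_def)
qed

lemma pos_add:
  assumes "pos a" "pos b"
  shows "pos (a + b)"
proof -
  obtain k l where "k > 0" "contr (k *\<^sub>R a)" "l > 0" "contr (l *\<^sub>R b)"
    using assms by (auto simp: pos_def)
  then have "contr (min k l *\<^sub>R a)" "contr (min k l *\<^sub>R b)"
    by (auto intro: contr_antimono)
  from contr_half_add[OF this] have "contr ((min k l / 2) *\<^sub>R (a + b))"
    by (simp add: algebra_simps)
  then show ?thesis
    using assms \<open>k > 0\<close> \<open>l > 0\<close> unfolding pos_def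
    by (intro conjI exI[of _ "min k l / 2"]) (auto simp: star_add)
qed

lemma pos_scaleR:
  assumes "pos a" "r > 0"
  shows "pos (r *\<^sub>R a)"
proof -
  obtain k where "k > 0" "contr (k *\<^sub>R a)"
    using assms by (auto simp: pos_def)
  then show ?thesis
    using assms unfolding pos_def
    by (intro conjI exI[of _ "k / r"]) (auto simp: star_scaleR)
qed

section \<open>Square roots by iteration\<close>

text \<open>Both components run together because the update of the algebra element uses the current
  scalar.\<close>

definition newton :: "real \<Rightarrow> 'a \<Rightarrow> nat \<Rightarrow> real \<times> 'a" where
  "newton \<zeta> b n = ((\<lambda>(l, r). ((1 + l\<^sup>2) / 2, (1/2) *\<^sub>R (b + (2 * \<zeta> * l) *\<^sub>R r - r * r))) ^^ n) (0, 0)"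

text \<open>
  For \<^term>\<open>\<zeta> = 1\<close> the equation below says \<^term>\<open>r * r = b\<close>; for \<^term>\<open>\<zeta> = 0\<close> it says
  that \<open>1 + r\<close> is a square root of \<open>1 + b\<close> in the unitization. With \<open>z = \<zeta> - b\<close>, the
  proof solves \<open>l = (z + l\<^sup>2) / 2\<close> by iteration from 0, dominated by the scalar iteration
  for \<open>z = 1\<close>; the element \<open>r\<^sub>n = \<zeta> \<lambda>\<^sub>n - l\<^sub>n\<close> has no scalar part.
\<close>
lemma square_root_exists:
  assumes \<zeta>: "\<zeta> = 0 \<or> \<zeta> = 1" and z: "\<And>c. norm (\<zeta> *\<^sub>R c - b * c) \<le> norm c"
    and sa: "star b = b"
  obtains r where "star r = r" "\<And>x. b * x = x * b \<Longrightarrow> r * x = x * r"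
    "r * r = b + (2 * \<zeta> - 2) *\<^sub>R r" "\<And>c. norm (\<zeta> *\<^sub>R c - r * c) \<le> norm c"
proof -
  define lam where "lam = (\<lambda>n. fst (newton \<zeta> b n))"
  define r where "r = (\<lambda>n. snd (newton \<zeta> b n))"
  have lam0: "lam 0 = 0" and lamS: "lam (Suc n) = (1 + (lam n)\<^sup>2) / 2" for n
    by (simp_all add: lam_def newton_def case_prod_beta)
  have r0: "r 0 = 0" and rS: "r (Suc n) = (1/2) *\<^sub>R (b + (2 * \<zeta> * lam n) *\<^sub>R r n - r n * r n)" for n
    by (simp_all add: lam_def r_def newton_def case_prod_beta)
  have \<zeta>2: "\<zeta> * \<zeta> = \<zeta>" and \<zeta>le: "0 \<le> \<zeta>" "\<zeta> \<le> 1" using \<zeta> by auto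
  \<comment> \<open>\<open>l n\<close> is left multiplication by an element of the unitization with
    scalar part \<open>\<zeta> * lam n\<close>; using the operator avoids constructing the
    unitization.\<close>
  define l where "l = (\<lambda>n c. (\<zeta> * lam n) *\<^sub>R c - r n * c)"
  have l_diff: "l n (x - y) = l n x - l n y" for n x y
    by (simp add: l_def algebra_simps)
  have lS: "l (Suc n) c = (1/2) *\<^sub>R ((\<zeta> *\<^sub>R c - b * c) + l n (l n c))" for n c
  proof -
    have "2 *\<^sub>R l (Suc n) c = (\<zeta> *\<^sub>R c - b * c) + l n (l n c)"
      using \<zeta> by (auto simp: l_def lamS rS algebra_simps power2_eq_square simp flip: scaleR_add_left)
    from arg_cong[OF this, of "scaleR (1/2)"] show ?thesis by simp
  qed
  have lam_bounds: "0 \<le> lam n \<and> lam n \<le> 1" for n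
  proof (induction n)
    case (Suc n)
    then have "(lam n)\<^sup>2 \<le> 1" by (simp add: abs_square_le_1)
    then show ?case by (simp add: lamS)
  qed (simp add: lam0)
  have lam_mono: "lam n \<le> lam (Suc n)" for n
    using zero_le_power2[of "lam n - 1"] by (simp add: lamS power2_diff)
  have l_bound: "norm (l n c) \<le> lam n * norm c" for n c
  proof (induction n arbitrary: c)
    case 0
    then show ?case by (simp add: l_def lam0 r0)
  next
    case (Suc n)
    have "norm (l n (l n c)) \<le> lam n * (lam n * norm c)"
      using Suc[of "l n c"] Suc[of c] lam_bounds[of n] by (meson mult_left_mono order_trans)
    then have "norm (\<zeta> *\<^sub>R c - b * c + l n (l n c)) \<le> norm c + lam n * (lam n * norm c)"
      using z[of c] norm_triangle_mono by blast
    moreover have "norm (l (Suc n) c) = norm (\<zeta> *\<^sub>R c - b * c + l n (l n c)) / 2"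
      by (simp only: lS norm_scaleR)
    ultimately show ?case
      by (simp add: lamS power2_eq_square algebra_simps)
  qed
  have l_step: "norm (l (Suc n) c - l n c) \<le> (lam (Suc n) - lam n) * norm c" for n c
  proof (induction n arbitrary: c)
    case 0
    then show ?case using z[of c] by (simp add: lS) (simp add: l_def lam0 lamS r0)
  next
    case (Suc n)
    let ?d = "l (Suc n) c - l n c"
    \<comment> \<open>The difference of squares p p - q q is split as p (p - q) + (p - q) q, which
      needs no commutativity; the same identity for \<open>lam\<close> closes the estimate.\<close>
    have "l (Suc (Suc n)) c - l (Suc n) c
        = (1/2) *\<^sub>R (l (Suc n) ?d + (l (Suc n) (l n c) - l n (l n c)))"
      unfolding lS[of "Suc n"] lS[of n] l_diff by (simp add: algebra_simps lS)
    moreover have "norm (l (Suc n) ?d) \<le> lam (Suc n) * ((lam (Suc n) - lam n) * norm c)"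
      using l_bound[of "Suc n" ?d] Suc[of c] lam_bounds[of "Suc n"] by (meson mult_left_mono order_trans)
    moreover have "norm (l (Suc n) (l n c) - l n (l n c)) \<le> (lam (Suc n) - lam n) * (lam n * norm c)"
      using Suc[of "l n c"] l_bound[of n c] lam_mono[of n]
      by (meson mult_left_mono order_trans diff_ge_0_iff_ge)
    ultimately have "norm (l (Suc (Suc n)) c - l (Suc n) c)
        \<le> (lam (Suc n) * ((lam (Suc n) - lam n) * norm c) + (lam (Suc n) - lam n) * (lam n * norm c)) / 2"
      by (simp add: norm_triangle_mono)
    also have "\<dots> = (lam (Suc (Suc n)) - lam (Suc n)) * norm c"
      unfolding lamS[of "Suc n"] by (simp add: lamS[of n] power2_eq_square field_simps)
    finally show ?case .
  qed
  \<comment> \<open>One increment of \<open>lam\<close> accounts for the scalar part, the other for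
    the change of \<open>l n\<close>.\<close>
  have r_step: "norm (r (Suc n) - r n) \<le> 2 * (lam (Suc n) - lam n)" for n
  proof (rule norm_le_of_left_mult)
    fix c
    have "(r (Suc n) - r n) * c = \<zeta> *\<^sub>R (lam (Suc n) - lam n) *\<^sub>R c - (l (Suc n) c - l n c)"
      by (simp add: l_def algebra_simps)
    then have "norm ((r (Suc n) - r n) * c)
        \<le> norm (\<zeta> *\<^sub>R (lam (Suc n) - lam n) *\<^sub>R c) + norm (l (Suc n) c - l n c)"
      by (simp only: norm_triangle_ineq4)
    also have "\<dots> \<le> (lam (Suc n) - lam n) * norm c + (lam (Suc n) - lam n) * norm c"
      using lam_mono[of n] \<zeta> l_step[of n c] by (intro add_mono) auto
    finally show "norm ((r (Suc n) - r n) * c) \<le> 2 * (lam (Suc n) - lam n) * norm c"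
      by (simp add: algebra_simps)
  qed (use lam_mono[of n] in simp)
  have "convergent lam"
    by (rule Bseq_mono_convergent[OF BseqI'[of _ 1]])
      (use lam_bounds lam_mono lift_Suc_mono_le[of lam] in auto)
  then obtain L where L: "lam \<longlonglongrightarrow> L" by (auto simp: convergent_def)
  have "(\<lambda>n. lam (Suc n)) \<longlonglongrightarrow> (1 + L\<^sup>2) / 2"
    unfolding lamS by (intro tendsto_intros L) simp
  then have "L = (1 + L\<^sup>2) / 2"
    using LIMSEQ_Suc[OF L] LIMSEQ_unique by blast
  then have "(L - 1)\<^sup>2 = 0" by (simp add: power2_diff)
  then have L1: "lam \<longlonglongrightarrow> 1" using L by simp
  \<comment> \<open>The increments of \<open>lam\<close> telescope, so they dominate those of
    \<open>r\<close> by a convergent series.\<close>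
  have "summable (\<lambda>n. 2 * (lam (Suc n) - lam n))"
    by (intro summable_mult telescope_summable[OF L])
  then have "summable (\<lambda>n. r (Suc n) - r n)"
    by (rule summable_comparison_test[rotated]) (use r_step in auto)
  then have "(\<lambda>n. \<Sum>k<n. r (Suc k) - r k) \<longlonglongrightarrow> (\<Sum>n. r (Suc n) - r n)"
    by (rule summable_LIMSEQ)
  then obtain R where R: "r \<longlonglongrightarrow> R"
    by (auto simp: sum_lessThan_telescope r0)
  show thesis
  proof
    have "star (r n) = r n" for n
      by (induction n) (auto simp: r0 rS star_scaleR star_add star_diff star_mult sa)
    with tendsto_star[OF R] R show "star R = R"
      by (simp add: LIMSEQ_unique)
  next
    fix x assume x: "b * x = x * b"
    have "r n * x = x * r n" for n
    proof (induction n)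
      case (Suc n)
      have "r n * r n * x = x * (r n * r n)"
        using Suc by (metis mult.assoc)
      then show ?case using Suc x by (simp add: rS algebra_simps)
    qed (simp add: r0)
    moreover have "(\<lambda>n. r n * x) \<longlonglongrightarrow> R * x" "(\<lambda>n. x * r n) \<longlonglongrightarrow> x * R"
      by (intro tendsto_intros R)+
    ultimately show "R * x = x * R" by (simp add: LIMSEQ_unique)
  next
    have "(\<lambda>n. r (Suc n)) \<longlonglongrightarrow> (1/2) *\<^sub>R (b + (2 * \<zeta> * 1) *\<^sub>R R - R * R)"
      unfolding rS by (intro tendsto_intros R L1)
    then have "R = (1/2) *\<^sub>R (b + (2 * \<zeta>) *\<^sub>R R - R * R)"
      using LIMSEQ_Suc[OF R] LIMSEQ_unique by fastforce
    from arg_cong[OF this, of "scaleR 2"] have "2 *\<^sub>R R = b + (2 * \<zeta>) *\<^sub>R R - R * R"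
      by simp
    then show "R * R = b + (2 * \<zeta> - 2) *\<^sub>R R" by (simp add: algebra_simps)
  next
    fix c
    have "(\<lambda>n. norm (l n c)) \<longlonglongrightarrow> norm ((\<zeta> * 1) *\<^sub>R c - R * c)"
      unfolding l_def by (intro tendsto_intros R L1)
    moreover have "norm (l n c) \<le> norm c" for n
      using order_trans[OF l_bound mult_right_mono[of "lam n" 1 "norm c"]] lam_bounds[of n] by simp
    ultimately show "norm (\<zeta> *\<^sub>R c - R * c) \<le> norm c"
      using LIMSEQ_le_const2 by fastforce
  qed
qed

section \<open>Positivity of squares and properness of the positive cone\<close>

text \<open>In the C*-identity for u + i v the cross terms are i times
  \<open>star u * v - star v * u\<close>, which vanishes by assumption.\<close>

lemma norm_add_cscale_ii:
  assumes "star u * v = star v * u"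
  shows "(norm (u + cscale \<i> v))\<^sup>2 = norm (star u * u + star v * v)"
proof -
  have "star (u + cscale \<i> v) * (u + cscale \<i> v)
      = star u * u + star v * v + cscale \<i> (star u * v - star v * u)"
    by (simp add: star_add star_cscale_ii algebra_simps cscale_mult_left[symmetric]
        cscale_mult_right[symmetric] cscale_ii_ii cscale_diff)
  also have "cscale \<i> (star u * v - star v * u) = 0"
    using assms cscale_add_right[of \<i> 0 0] by simp
  finally show ?thesis
    using cstar_identity[of "u + cscale \<i> v"] by simp
qed

text \<open>With 1 + r a square root of 1 - a a, left multiplication by each of 1 + r + i a and 1 +
  r - i a is isometric. Their mean 1 + r is then a contraction, and so is its square 1 - a
  a.\<close>

lemma contr_square:
  assumes "star a = a" "norm a \<le> 1"
  shows "contr (a * a)"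
proof -
  have z: "norm (0 *\<^sub>R c - - (a * a) * c) \<le> norm c" for c
  proof -
    have "norm (a * (a * c)) \<le> norm a * (norm a * norm c)"
      by (meson norm_mult_ineq mult_left_mono norm_ge_zero order_trans)
    also have "\<dots> \<le> 1 * (1 * norm c)"
      using assms(2) by (intro mult_mono) auto
    finally show ?thesis by (simp add: mult.assoc)
  qed
  have "star (- (a * a)) = - (a * a)"
    using assms(1) by (simp add: star_mult)
  from square_root_exists[OF disjI1[OF refl] z this]
  obtain r where r: "star r = r" "\<And>x. - (a * a) * x = x * - (a * a) \<Longrightarrow> r * x = x * r"
      "r * r = - (a * a) + (2 * 0 - 2) *\<^sub>R r"
    by this (rule that)
  have ra: "r * a = a * r"
    using r(2) by (simp add: mult.assoc)
  define w where "w = (\<lambda>c. c + r * c)"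
  have rr: "r * (r * c) = - (a * (a * c)) - 2 *\<^sub>R (r * c)" for c
    using arg_cong[OF r(3), of "\<lambda>u. u * c"] by (simp add: mult.assoc left_diff_distrib)
  have rac: "r * (a * c) = a * (r * c)" for c
    using ra by (metis mult.assoc)
  have iso: "norm (w c + cscale \<i> (s *\<^sub>R (a * c))) = norm c" if "s = 1 \<or> s = - 1" for c s
  proof -
    have "star (w c) * (s *\<^sub>R (a * c)) = star (s *\<^sub>R (a * c)) * w c"
      by (simp add: w_def star_add star_mult star_scaleR r(1) assms(1) distrib_left distrib_right
          mult.assoc rac scaleR_right_distrib)
    then have "(norm (w c + cscale \<i> (s *\<^sub>R (a * c))))\<^sup>2
        = norm (star (w c) * w c + star (s *\<^sub>R (a * c)) * (s *\<^sub>R (a * c)))"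
      by (rule norm_add_cscale_ii)
    also have "star (w c) * w c + star (s *\<^sub>R (a * c)) * (s *\<^sub>R (a * c)) = star c * c"
      using that by (auto simp: w_def star_add star_mult star_scaleR r(1) assms(1) algebra_simps rr scaleR_2)
    finally show ?thesis
      by (simp add: cstar_identity)
  qed
  have w: "norm (w c) \<le> norm c" for c
  proof -
    have "2 * norm (w c) = norm (2 *\<^sub>R w c)" by simp
    also have "2 *\<^sub>R w c = (w c + cscale \<i> (1 *\<^sub>R (a * c))) + (w c + cscale \<i> ((- 1) *\<^sub>R (a * c)))"
      by (simp add: scaleR_2 cscale_minus)
    also have "norm \<dots> \<le> norm c + norm c"
      by (intro norm_triangle_mono eq_refl iso) simp_all
    finally show ?thesis by simp
  qed
  have "c - a * a * c = w (w c)" for c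
    by (simp add: w_def algebra_simps rr scaleR_2)
  then show ?thesis
    using order_trans[OF w w] by (simp add: contr_def)
qed

lemma pos_square:
  assumes "star a = a"
  shows "pos (a * a)"
proof -
  define k where "k = 1 / (1 + norm a)"
  have k: "k > 0" "k * norm a \<le> 1"
    by (simp_all add: k_def add_pos_nonneg)
  then have "contr ((k * k) *\<^sub>R (a * a))"
    using contr_square[of "k *\<^sub>R a"] assms by (simp add: star_scaleR)
  then show ?thesis
    using k assms unfolding pos_def by (intro conjI exI[of _ "k * k"]) (auto simp: star_mult)
qed

text \<open>
  Here \<open>1 + 2 a\<close> is the mean of the squares of \<open>1 + (1 + \<i>) a\<close> and \<open>1 + (1 - \<i>) a\<close>, each of
  which is the mean of the squares of \<open>1 + a\<close> and \<open>1 \<plusminus> \<i> a\<close>; and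
  \<open>\<parallel>1 \<plusminus> \<i> a\<parallel>\<^sup>2 = \<parallel>1 + a\<^sup>2\<parallel>\<close>, where \<open>1 + a\<^sup>2\<close> is the mean of the squares of \<open>1 + a\<close> and \<open>1 - a\<close>.
\<close>
lemma contr_uminus_double:
  assumes "star a = a" "contr a" "contr (- a)"
  shows "contr (- (2 *\<^sub>R a))"
proof -
  have p: "norm (c + a * c) \<le> norm c" "norm (c - a * c) \<le> norm c" for c
    using assms(2,3) by (auto simp: contr_def)
  have aa: "norm (c + a * (a * c)) \<le> norm c" for c
  proof -
    have "2 * norm (c + a * (a * c)) = norm (2 *\<^sub>R (c + a * (a * c)))" by simp
    also have "2 *\<^sub>R (c + a * (a * c)) = ((c + a * c) + a * (c + a * c)) + ((c - a * c) - a * (c - a * c))"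
      by (simp add: algebra_simps scaleR_2)
    also have "norm \<dots> \<le> norm c + norm c"
      using order_trans[OF p(1) p(1)] order_trans[OF p(2) p(2)] by (rule norm_triangle_mono)
    finally show ?thesis by simp
  qed
  define q where "q = (\<lambda>s c. c + cscale \<i> (s *\<^sub>R (a * c)))"
  have q: "norm (q s c) \<le> norm c" if "s = 1 \<or> s = - 1" for s c
  proof -
    have "(norm (q s c))\<^sup>2 = norm (star c * c + star (s *\<^sub>R (a * c)) * (s *\<^sub>R (a * c)))"
      unfolding q_def by (rule norm_add_cscale_ii) (simp add: star_scaleR star_mult assms(1) mult.assoc)
    also have "star c * c + star (s *\<^sub>R (a * c)) * (s *\<^sub>R (a * c)) = star c * (c + a * (a * c))"
      using that by (auto simp: star_scaleR star_mult assms(1) algebra_simps)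
    also have "norm \<dots> \<le> norm c * norm c"
      using norm_mult_ineq[of "star c" "c + a * (a * c)"] aa[of c]
      by (metis norm_star mult_left_mono norm_ge_zero order_trans)
    finally have "(norm (q s c))\<^sup>2 \<le> (norm c)\<^sup>2"
      by (simp add: power2_eq_square)
    then show ?thesis
      by (rule power2_le_imp_le) simp
  qed
  define m where "m = (\<lambda>s c. c + a * c + cscale \<i> (s *\<^sub>R (a * c)))"
  have m: "norm (m s c) \<le> norm c" if s: "s = 1 \<or> s = - 1" for s c
  proof -
    have "2 * norm (m s c) = norm (2 *\<^sub>R m s c)" by simp
    also have "2 *\<^sub>R m s c = ((c + a * c) + a * (c + a * c)) + q s (q s c)"
      using s by (auto simp: m_def q_def algebra_simps scaleR_2 cscale_add_right cscale_minus
          cscale_diff cscale_ii_ii cscale_mult_right[symmetric])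
    also have "norm \<dots> \<le> norm c + norm c"
      using order_trans[OF p(1) p(1)] order_trans[OF q[OF s] q[OF s]] by (rule norm_triangle_mono)
    finally show ?thesis by simp
  qed
  have "norm (c + 2 *\<^sub>R (a * c)) \<le> norm c" for c
  proof -
    have "2 * norm (c + 2 *\<^sub>R (a * c)) = norm (2 *\<^sub>R (c + 2 *\<^sub>R (a * c)))" by simp
    also have "2 *\<^sub>R (c + 2 *\<^sub>R (a * c)) = m 1 (m 1 c) + m (- 1) (m (- 1) c)"
      by (simp add: m_def algebra_simps scaleR_2 cscale_add_right cscale_minus
          cscale_diff cscale_ii_ii cscale_mult_right[symmetric])
    also have "norm \<dots> \<le> norm c + norm c"
      using order_trans[OF m m, of 1 1] order_trans[OF m m, of "- 1" "- 1"] by (intro norm_triangle_mono) auto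
    finally show ?thesis by simp
  qed
  then show ?thesis by (simp add: contr_def)
qed

text \<open>For a small multiple \<open>b\<close> of \<open>a\<close>, both \<open>b\<close> and
  \<open>- b\<close> satisfy \<open>contr\<close>. Doubling preserves this, so all the elements
  \<open>2 ^ n *\<^sub>R b\<close> have norm at most 2.\<close>

lemma pos_antisym:
  assumes "pos a" "pos (- a)"
  shows "a = 0"
proof -
  have sa: "star a = a" using assms by (simp add: pos_def)
  obtain k l where kl: "k > 0" "contr (k *\<^sub>R a)" "l > 0" "contr (l *\<^sub>R (- a))"
    using assms by (auto simp: pos_def)
  define b where "b = min k l *\<^sub>R a"
  have b0: "star b = b" "contr b" "contr (- b)"
    using kl contr_antimono[of k a "min k l"] contr_antimono[of l "- a" "min k l"] sa
    by (auto simp: b_def star_scaleR)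
  have pow: "contr ((2 ^ n) *\<^sub>R b) \<and> contr (- ((2 ^ n) *\<^sub>R b))" for n :: nat
  proof (induction n)
    case (Suc n)
    let ?b = "(2 ^ n) *\<^sub>R b"
    have "contr (- (2 *\<^sub>R ?b))"
      using Suc b0(1) by (intro contr_uminus_double) (auto simp: star_scaleR)
    moreover have "contr (- (2 *\<^sub>R (- ?b)))"
      using Suc b0(1) by (intro contr_uminus_double) (auto simp: star_scaleR)
    ultimately show ?case by simp
  qed (use b0 in simp)
  have bound: "2 ^ n * norm b \<le> 2" for n :: nat
  proof -
    have "norm ((2 ^ n) *\<^sub>R b) \<le> 2"
    proof (rule norm_le_of_left_mult)
      fix c
      have "norm (c - (c - (2 ^ n *\<^sub>R b) * c)) \<le> norm c + norm (c - (2 ^ n *\<^sub>R b) * c)"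
        by (rule norm_triangle_ineq4)
      also have "\<dots> \<le> norm c + norm c"
        using pow[of n] unfolding contr_def by (intro add_left_mono) blast
      finally show "norm ((2 ^ n *\<^sub>R b) * c) \<le> 2 * norm c" by simp
    qed simp
    then show ?thesis by simp
  qed
  have "b = 0"
  proof (rule ccontr)
    assume "b \<noteq> 0"
    moreover obtain n where "2 / norm b < 2 ^ n"
      using real_arch_pow[of 2 "2 / norm b"] by auto
    ultimately show False using bound[of n] by (simp add: field_simps)
  qed
  then show ?thesis using kl by (auto simp: b_def)
qed

section \<open>The Kelley-Vaught argument and Jordan annihilation\<close>

text \<open>
  If \<open>\<parallel>1 - e\<parallel> > 1\<close> for \<open>e = star y * y\<close>, then the powers of the self-adjoint \<open>1 - e\<close> would grow
  exponentially, whereas the intertwining \<open>y e = (y y\<^sup>*) y\<close> only allows linear growth.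
\<close>
lemma contr_star_mult_commute:
  assumes "contr (y * star y)"
  shows "contr (star y * y)"
  unfolding contr_def
proof (rule allI, rule ccontr)
  fix c
  define e where "e = star y * y"
  define T where "T = (\<lambda>c. c - e * c)"
  define S where "S = (\<lambda>c. c - y * star y * c)"
  assume "\<not> norm (c - star y * y * c) \<le> norm c"
  then have gt: "norm (T c) > norm c" by (simp add: T_def e_def)
  define N where "N = (\<lambda>n. norm ((T ^^ n) c))"
  have "c \<noteq> 0" using gt by (auto simp: T_def)
  then have N0: "N 0 > 0" by (simp add: N_def)
  define q where "q = N 1 / N 0"
  have q: "q > 1" using gt N0 by (simp add: q_def N_def)
  \<comment> \<open>Log-convexity of \<open>N\<close>, from self-adjointness of 1 - e; hence the
    ratios of successive terms never fall below the first one, \<open>q\<close>.\<close>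
  have convex: "N (Suc n) * N (Suc n) \<le> N n * N (Suc (Suc n))" for n
  proof -
    let ?x = "(T ^^ n) c"
    have "star (T ?x) * T ?x = star ?x * T (T ?x)"
      by (simp add: T_def e_def star_diff star_mult star_star algebra_simps)
    then have "(norm (T ?x))\<^sup>2 = norm (star ?x * T (T ?x))"
      using cstar_identity[of "T ?x"] by simp
    also have "\<dots> \<le> norm ?x * norm (T (T ?x))"
      using norm_mult_ineq[of "star ?x" "T (T ?x)"] by simp
    finally show ?thesis by (simp add: N_def power2_eq_square)
  qed
  have growth: "N n > 0 \<and> q * N n \<le> N (Suc n)" for n
  proof (induction n)
    case 0
    then show ?case using N0 by (simp add: q_def)
  next
    case (Suc n)
    then have pos: "N (Suc n) > 0"
      using q by (smt (verit) mult_pos_pos)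
    have "N n * (q * N (Suc n)) \<le> N (Suc n) * N (Suc n)"
      using mult_right_mono[of "q * N n" "N (Suc n)" "N (Suc n)"] Suc pos by (simp add: mult_ac)
    also note convex[of n]
    finally show ?case using Suc pos by simp
  qed
  have exp: "q ^ n * N 0 \<le> N n" for n
  proof (induction n)
    case (Suc n)
    have "q ^ Suc n * N 0 = q * (q ^ n * N 0)" by simp
    also have "\<dots> \<le> q * N n" using Suc q by simp
    also have "\<dots> \<le> N (Suc n)" using growth by blast
    finally show ?case .
  qed simp
  have yT: "y * (T ^^ n) x = (S ^^ n) (y * x)" for n x
  proof (induction n)
    case (Suc n)
    have "y * T z = S (y * z)" for z
      by (simp add: T_def S_def e_def algebra_simps)
    then show ?case using Suc by simp
  qed simp
  have Sn: "norm ((S ^^ n) x) \<le> norm x" for n x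
  proof (induction n)
    case (Suc n)
    have "norm (S z) \<le> norm z" for z
      using assms by (simp add: S_def contr_def)
    then show ?case using Suc order_trans by simp blast
  qed simp
  define K where "K = norm y * (norm y * norm c)"
  \<comment> \<open>Each application of \<open>T\<close> subtracts
    \<open>star y * (S ^^ n) (y * c)\<close>, which stays bounded because \<open>S\<close> is a
    contraction.\<close>
  have linear: "N n \<le> N 0 + n * K" for n
  proof (induction n)
    case (Suc n)
    have "(T ^^ Suc n) c = (T ^^ n) c - star y * (S ^^ n) (y * c)"
      by (simp add: T_def e_def mult.assoc flip: yT)
    then have "N (Suc n) \<le> N n + norm (star y * (S ^^ n) (y * c))"
      unfolding N_def by (simp only: norm_triangle_ineq4)
    also have "norm (star y * (S ^^ n) (y * c)) \<le> norm y * norm ((S ^^ n) (y * c))"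
      using norm_mult_ineq[of "star y"] by simp
    also have "\<dots> \<le> K"
      unfolding K_def using order_trans[OF Sn norm_mult_ineq] by (intro mult_left_mono) auto
    finally show ?case using Suc by (simp add: algebra_simps)
  qed simp
  have "(\<lambda>n. 1 * (inverse q ^ n) + real n * inverse q ^ n * (K / N 0)) \<longlonglongrightarrow> 1 * 0 + 0 * (K / N 0)"
    using q powser_times_n_limit_0[of "inverse q"]
    by (intro tendsto_intros LIMSEQ_power_zero) (auto simp: inverse_less_1_iff)
  then have "\<forall>\<^sub>F n in sequentially. 1 * (inverse q ^ n) + real n * inverse q ^ n * (K / N 0) < 1"
    by (rule order_tendstoD) simp
  then obtain n where n: "inverse q ^ n + real n * inverse q ^ n * (K / N 0) < 1"
    by (auto simp: eventually_sequentially)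
  have "q ^ n * N 0 \<le> N 0 + n * K"
    using exp linear order_trans by blast
  then show False
    using n q N0 by (simp add: field_simps power_inverse)
qed

lemma pos_star_mult_commute:
  assumes "pos (y * star y)"
  shows "pos (star y * y)"
proof -
  obtain k where k: "k > 0" "contr (k *\<^sub>R (y * star y))"
    using assms by (auto simp: pos_def)
  then have "contr (k *\<^sub>R (star y * y))"
    using contr_star_mult_commute[of "sqrt k *\<^sub>R y"] by (simp add: star_scaleR)
  then show ?thesis
    using k by (auto simp: pos_def star_mult star_star)
qed

text \<open>
  With \<open>r = \<bar>s\<bar>\<close> and \<open>k = r - s\<close>, twice the negative part of \<open>s = star x * x\<close>, the element
  \<open>y = x k\<close> satisfies \<open>star y * y = - k r k\<close>, which is negative, while \<open>y y\<^sup>* + y\<^sup>* y\<close> is a sum of squares.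
\<close>
lemma star_mult_eq_abs:
  assumes r: "star r = r" "r * r = (star x * x) * (star x * x)"
    and com: "r * (star x * x) = (star x * x) * r"
    and \<rho>: "star \<rho> = \<rho>" "\<rho> * \<rho> = r" "\<rho> * (star x * x) = (star x * x) * \<rho>"
  shows "star x * x = r"
proof -
  define s where "s = star x * x"
  have s: "star s = s" by (simp add: s_def star_mult star_star)
  have rr: "r * r = s * s" and rs: "r * s = s * r" and \<rho>s: "\<rho> * s = s * \<rho>"
    using r(2) com \<rho>(3) by (simp_all add: s_def)
  define k where "k = r - s"
  have k: "star k = k" by (simp add: k_def star_diff r(1) s)
  have \<rho>r: "\<rho> * r = r * \<rho>" using \<rho>(2) by (metis mult.assoc)
  have \<rho>k: "\<rho> * k = k * \<rho>" by (simp add: k_def right_diff_distrib left_diff_distrib \<rho>r \<rho>s)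
  have sk: "s * k = - (r * k)"
    by (simp add: k_def right_diff_distrib rr rs)
  have kk: "k * k = 2 *\<^sub>R (r * k)"
    by (simp add: k_def right_diff_distrib left_diff_distrib rr rs scaleR_2)
  define y where "y = x * k"
  \<comment> \<open>The square root \<open>\<rho>\<close> of \<open>r\<close> commutes with
    \<open>k\<close>, so k r k becomes the square of the self-adjoint
    \<open>\<rho> * k\<close>.\<close>
  have yy: "star y * y = - ((\<rho> * k) * (\<rho> * k))"
  proof -
    have "star y * y = k * (s * k)"
      by (simp add: y_def star_mult k s_def mult.assoc)
    also have "\<dots> = - ((\<rho> * k) * (\<rho> * k))"
      by (metis sk \<rho>(2) \<rho>k mult.assoc minus_mult_right)
    finally show ?thesis .
  qed
  have sa: "star (\<rho> * k) = \<rho> * k" by (simp add: star_mult k \<rho>(1) \<rho>k)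
  have neg: "pos (- (star y * y))"
    unfolding yy using pos_square[OF sa] by simp
  \<comment> \<open>Up to sign and the factor 2, \<open>u\<close> and \<open>v\<close> are the real
    and imaginary parts of \<open>y\<close>; half the sum of their squares is
    \<open>y * star y + star y * y\<close>.\<close>
  define u where "u = y + star y"
  define v where "v = cscale \<i> (y - star y)"
  have "star u = u" "star v = v"
    by (simp_all add: u_def v_def star_add star_star star_cscale_ii star_diff cscale_diff)
  then have "pos ((1/2) *\<^sub>R (u * u) + (1/2) *\<^sub>R (v * v) + - (star y * y))"
    by (intro pos_add pos_scaleR pos_square neg) simp_all
  also have "(1/2) *\<^sub>R (u * u) + (1/2) *\<^sub>R (v * v) + - (star y * y) = y * star y"
  proof -
    have "u * u + v * v = 2 *\<^sub>R (y * star y + star y * y)"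
      by (simp add: u_def v_def algebra_simps cscale_mult_left[symmetric] cscale_mult_right[symmetric]
          cscale_ii_ii cscale_diff scaleR_2)
    then have "(1/2) *\<^sub>R (u * u + v * v) = y * star y + star y * y"
      by (simp del: scaleR_add_right)
    then show ?thesis by (simp add: scaleR_add_right)
  qed
  \<comment> \<open>Exchanging the factors makes \<open>star y * y\<close> positive as well as
    negative, hence zero.\<close>
  finally have "pos (star y * y)"
    by (rule pos_star_mult_commute)
  with neg have "star y * y = 0" by (intro pos_antisym)
  then have "(\<rho> * k) * (\<rho> * k) = 0" using yy by simp
  then have "\<rho> * k = 0" using star_mult_self_eq_0[of "\<rho> * k"] sa by simp
  then have "r * k = 0" by (metis \<rho>(2) mult.assoc mult_zero_right)
  then have "k * k = 0" using kk by simp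
  then have "k = 0" using star_mult_self_eq_0[of k] k by simp
  then show ?thesis by (simp add: k_def s_def)
qed

text \<open>After scaling to norm at most 1, the square root of s s given by the iteration commutes
  with everything that commutes with s s, and it equals s itself.\<close>

lemma commute_star_mult_if_commute_square:
  assumes "(star x * x) * (star x * x) * a = a * ((star x * x) * (star x * x))"
  shows "(star x * x) * a = a * (star x * x)"
proof -
  define d where "d = 1 / (1 + norm x)"
  have d: "d > 0" "d * norm x \<le> 1"
    by (simp_all add: d_def add_pos_nonneg)
  define s where "s = star (d *\<^sub>R x) * (d *\<^sub>R x)"
  have s_eq: "s = (d * d) *\<^sub>R (star x * x)"
    by (simp add: s_def star_scaleR)
  have s: "star s = s" unfolding s_def star_mult star_star ..
  have "norm s = (d * norm x)\<^sup>2"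
    unfolding s_def cstar_identity using d(1) by simp
  also have "\<dots> \<le> 1"
    using d by (simp add: abs_square_le_1)
  finally have "contr (s * s)"
    using s by (intro contr_square)
  then have z1: "norm (1 *\<^sub>R c - s * s * c) \<le> norm c" for c
    by (simp add: contr_def)
  have "star (s * s) = s * s" by (simp add: star_mult s)
  from square_root_exists[OF disjI2[OF refl] z1 this]
  obtain r where r: "star r = r" "\<And>y. s * s * y = y * (s * s) \<Longrightarrow> r * y = y * r"
    "r * r = s * s + (2 * 1 - 2) *\<^sub>R r" "\<And>c. norm (1 *\<^sub>R c - r * c) \<le> norm c"
    by this (rule that)
  \<comment> \<open>The bound \<open>r(4)\<close> on 1 - r is exactly what a second extraction
    needs; it yields the fourth root of s s.\<close>
  from square_root_exists[OF disjI2[OF refl] r(4) r(1)]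
  obtain \<rho> where \<rho>: "star \<rho> = \<rho>" "\<And>y. r * y = y * r \<Longrightarrow> \<rho> * y = y * \<rho>"
    "\<rho> * \<rho> = r + (2 * 1 - 2) *\<^sub>R \<rho>" "\<And>c. norm (1 *\<^sub>R c - \<rho> * c) \<le> norm c"
    by this (rule that)
  have rs: "r * s = s * r"
    by (rule r(2)) (simp only: mult.assoc)
  have "r * r = s * s" "\<rho> * \<rho> = r" using r(3) \<rho>(3) by simp_all
  then have "s = r"
    using star_mult_eq_abs[of r "d *\<^sub>R x" \<rho>, folded s_def] r(1) rs \<rho>(1) \<rho>(2)[OF rs] by blast
  moreover have "r * a = a * r"
    by (rule r(2)) (use assms in \<open>simp add: s_eq\<close>)
  ultimately have "s * a = a * s" by simp
  then show ?thesis using d(1) by (simp add: s_eq)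
qed

lemma jordan_annihilates_positive:
  assumes "a * (star x * x) + (star x * x) * a = 0"
  shows "a * (star x * x) = 0" "(star x * x) * a = 0"
proof -
  define s where "s = star x * x"
  have anti: "a * s = - (s * a)"
    using assms by (simp add: s_def eq_neg_iff_add_eq_0)
  have "s * s * a = a * (s * s)"
    using anti by (metis mult.assoc minus_mult_left minus_mult_right minus_minus)
  then have "s * a = a * s"
    unfolding s_def by (rule commute_star_mult_if_commute_square)
  then have "2 *\<^sub>R (a * s) = 0"
    using assms by (simp add: s_def scaleR_2)
  then show "a * (star x * x) = 0" "(star x * x) * a = 0"
    using \<open>s * a = a * s\<close> by (simp_all add: s_def)
qed

section \<open>Two-sided annihilators and the lattice of annihilators\<close>

text \<open>Associative substitute for the Jordan annihilator \<open>Ann\<close>: the two agree on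
  sets of positive elements, and on \<open>zann T\<close> for star-closed \<open>T\<close>.\<close>

definition zann :: "'a set \<Rightarrow> 'a set" where
  "zann T = {a. \<forall>y\<in>T. a * y = 0 \<and> y * a = 0}"

definition star_closed :: "'a set \<Rightarrow> bool" where
  "star_closed T \<longleftrightarrow> (\<forall>y\<in>T. star y \<in> T)"

lemma zann_antimono: "T \<subseteq> U \<Longrightarrow> zann U \<subseteq> zann T"
  by (auto simp: zann_def)

lemma subset_zann_zann: "T \<subseteq> zann (zann T)"
  by (auto simp: zann_def)

lemma zann_zann_zann [simp]: "zann (zann (zann T)) = zann T"
  using zann_antimono[OF subset_zann_zann[of T]] subset_zann_zann[of "zann T"] by blast

lemma zann_zann_mono: "T \<subseteq> U \<Longrightarrow> zann (zann T) \<subseteq> zann (zann U)"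
  by (intro zann_antimono)

lemma zero_in_zann: "0 \<in> zann T"
  by (simp add: zann_def)

lemma zann_zero [simp]: "zann {0} = UNIV"
  by (auto simp: zann_def)

lemma zann_UNIV [simp]: "zann UNIV = {0}"
proof -
  have "a = 0" if "a \<in> zann UNIV" for a
    by (rule mult_star_self_eq_0) (use that in \<open>simp add: zann_def\<close>)
  then show ?thesis using zero_in_zann by blast
qed

lemma zann_diff: "a \<in> zann T \<Longrightarrow> b \<in> zann T \<Longrightarrow> a - b \<in> zann T"
  by (auto simp: zann_def algebra_simps)

text \<open>Only the outer factors meet an element of \<open>T\<close>, so the middle factor is
  arbitrary.\<close>

lemma zann_hereditary:
  assumes "a \<in> zann T" "b \<in> zann T"
  shows "a * c * b \<in> zann T"
proof -
  have "a * c * b * y = 0 \<and> y * (a * c * b) = 0" if "y \<in> T" for y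
  proof
    have "b * y = 0" "y * a = 0" using assms that by (auto simp: zann_def)
    then show "a * c * b * y = 0" by (simp add: mult.assoc)
    show "y * (a * c * b) = 0" using \<open>y * a = 0\<close> by (simp flip: mult.assoc)
  qed
  then show ?thesis by (simp add: zann_def)
qed

lemma zann_mult:
  assumes "a \<in> zann T" "b \<in> zann T"
  shows "a * b \<in> zann T"
proof -
  have "a * b * y = 0 \<and> y * (a * b) = 0" if "y \<in> T" for y
  proof
    have "b * y = 0" "y * a = 0" using assms that by (auto simp: zann_def)
    then show "a * b * y = 0" by (simp add: mult.assoc)
    show "y * (a * b) = 0" using \<open>y * a = 0\<close> by (simp flip: mult.assoc)
  qed
  then show ?thesis by (simp add: zann_def)
qed

lemma star_closed_zann:
  assumes "star_closed T"
  shows "star_closed (zann T)"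
proof -
  have "star a * y = 0 \<and> y * star a = 0" if "a \<in> zann T" "y \<in> T" for a y
  proof -
    have "a * star y = 0" "star y * a = 0"
      using that assms by (auto simp: zann_def star_closed_def)
    then show ?thesis
      using star_mult_eq_0[of a "star y"] star_mult_eq_0[of "star y" a] by (simp add: star_star)
  qed
  then show ?thesis by (auto simp: zann_def star_closed_def)
qed

lemma star_closed_positive: "S \<subseteq> positive_part star \<Longrightarrow> star_closed S"
  by (auto simp: positive_part_def star_closed_def star_mult star_star)

text \<open>By the C*-identity, annihilating \<open>y * star y\<close> from the left already
  annihilates \<open>y\<close>. Thus a star-closed set may be replaced by positive elements.\<close>

lemma zann_star_squares:
  assumes "star_closed T" and S: "S = {star y * y | y. y \<in> T}"
  shows "zann S = zann T"
proof -
  have "a * y = 0 \<and> y * a = 0" if a: "a \<in> zann S" and y: "y \<in> T" for a y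
  proof -
    have "star y \<in> T" using assms(1) y by (simp add: star_closed_def)
    then have 1: "a * (star (star y) * star y) = 0" and 2: "(star y * y) * a = 0"
      using a y by (auto simp: zann_def S)
    from 2 have 3: "star a * (star y * y) = 0"
      using star_mult_eq_0[of "star y * y" a] by (simp add: star_mult star_star)
    have "a * star (star y) = 0" using 1 by (rule mult_star_mult_self_eq_0)
    moreover have "star (star y) * star (star a) = 0"
      by (rule star_mult_eq_0[OF mult_star_mult_self_eq_0[OF 3]])
    ultimately show ?thesis by (simp add: star_star)
  qed
  moreover have "zann T \<subseteq> zann S"
  proof
    fix a assume a: "a \<in> zann T"
    have "a * (star y * y) = 0 \<and> (star y * y) * a = 0" if "y \<in> T" for y
    proof
      have "a * star y = 0" "y * a = 0"
        using a that assms(1) by (auto simp: zann_def star_closed_def)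
      then show "(star y * y) * a = 0" by (simp add: mult.assoc)
      show "a * (star y * y) = 0" using \<open>a * star y = 0\<close> by (simp flip: mult.assoc)
    qed
    then show "a \<in> zann S" by (auto simp: zann_def S)
  qed
  ultimately show ?thesis unfolding zann_def by blast
qed

lemma zann_subset_Ann: "zann T \<subseteq> Ann T"
  by (auto simp: zann_def Ann_def)

lemma Ann_positive:
  assumes "S \<subseteq> positive_part star"
  shows "Ann S = zann S"
proof
  show "Ann S \<subseteq> zann S"
    using assms jordan_annihilates_positive
    by (force simp: Ann_def zann_def positive_part_def)
qed (rule zann_subset_Ann)

text \<open>\<open>zann T\<close> contains the elements \<open>star y * y\<close> formed from its
  members; these are positive and have the same two-sided annihilator as
  \<open>zann T\<close>.\<close>

lemma Ann_zann:
  assumes "star_closed T"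
  shows "Ann (zann T) = zann (zann T)"
proof
  let ?S = "{star y * y | y. y \<in> zann T}"
  have sc: "star_closed (zann T)" using assms by (rule star_closed_zann)
  have "?S \<subseteq> zann T"
    using sc by (auto simp: star_closed_def intro: zann_mult)
  then have "Ann (zann T) \<subseteq> Ann ?S"
    unfolding Ann_def by blast
  also have "\<dots> = zann ?S"
    by (rule Ann_positive) (auto simp: positive_part_def)
  also have "\<dots> = zann (zann T)"
    using sc by (rule zann_star_squares) simp
  finally show "Ann (zann T) \<subseteq> zann (zann T)" .
qed (rule zann_subset_Ann)

lemma annihilators_iff: "V \<in> annihilators star \<longleftrightarrow> star_closed V \<and> zann (zann V) = V"
proof
  assume "V \<in> annihilators star"
  then obtain S where S: "S \<subseteq> positive_part star" "V = Ann (Ann S)"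
    by (auto simp: annihilators_def)
  then have "V = zann (zann S)"
    by (simp add: Ann_positive Ann_zann star_closed_positive)
  then show "star_closed V \<and> zann (zann V) = V"
    using S by (simp add: star_closed_positive star_closed_zann)
next
  assume V: "star_closed V \<and> zann (zann V) = V"
  let ?S = "{star y * y | y. y \<in> V}"
  have S: "?S \<subseteq> positive_part star" by (auto simp: positive_part_def)
  have "Ann ?S = zann V"
    using V Ann_positive[OF S] zann_star_squares[of V ?S] by simp
  then have "Ann (Ann ?S) = V"
    using V by (simp add: Ann_zann)
  then show "V \<in> annihilators star"
    using S by (auto simp: annihilators_def)
qed

lemma zann_in_annihilators: "star_closed T \<Longrightarrow> zann T \<in> annihilators star"
  by (simp add: annihilators_iff star_closed_zann)

lemma UNIV_in_annihilators: "UNIV \<in> annihilators star"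
  by (simp add: annihilators_iff star_closed_def)

lemma zero_in_annihilators: "{0} \<in> annihilators star"
  by (simp add: annihilators_iff star_closed_def)

section \<open>Primeness of a factor, central supports and suprema\<close>

text \<open>Otherwise the ideal \<open>I\<close> of all \<open>a\<close> with
  \<open>a * v = 0\<close> and a A v = 0, which contains \<open>w\<close>, and its right annihilator
  \<open>J\<close>, which contains \<open>v\<close>, are nonzero proper ideals with product
  zero.\<close>

lemma factor_prime:
  fixes w v :: 'a
  assumes "cstar_factor cscale" and wAv: "\<And>b. w * b * v = 0"
  shows "w = 0 \<or> v = 0"
proof (rule ccontr)
  assume nz: "\<not> (w = 0 \<or> v = 0)"
  \<comment> \<open>\<open>a * v = 0\<close> is a separate condition because there may be no
    unit.\<close>
  define I where "I = {a. a * v = 0 \<and> (\<forall>b. a * b * v = 0)}"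
  define J where "J = {c. \<forall>a\<in>I. a * c = 0}"
  have "cscale c 0 = 0" for c
    using cscale_add_right[of c 0 0] by simp
  then have I: "two_sided_ideal cscale I"
    unfolding two_sided_ideal_def
  proof (intro conjI ballI allI)
    fix a x assume x: "x \<in> I"
    have "x * (a * b) * v = 0" for b using x by (simp add: I_def)
    then show "x * a \<in> I" using x by (simp add: I_def mult.assoc)
    show "a * x \<in> I" using x by (simp add: I_def mult.assoc)
  qed (auto simp: I_def distrib_right simp flip: cscale_mult_left)
  have J: "two_sided_ideal cscale J"
    unfolding two_sided_ideal_def
  proof (intro conjI ballI allI)
    fix a c assume c: "c \<in> J"
    have "y * a \<in> I" if "y \<in> I" for y
      using I that by (auto simp: two_sided_ideal_def)
    then have "y * a * c = 0" if "y \<in> I" for y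
      using c that by (auto simp: J_def)
    then show "a * c \<in> J" by (auto simp: J_def mult.assoc)
    show "c * a \<in> J" using c by (auto simp: J_def simp flip: mult.assoc)
  qed (auto simp: J_def distrib_left \<open>\<And>c. cscale c 0 = 0\<close> simp flip: cscale_mult_right)
  have "w \<in> I"
  proof -
    \<comment> \<open>Without a unit, \<open>w * v = 0\<close> has to be extracted from w A v = 0 by
      using the C*-identity twice, first for \<open>q\<close>.\<close>
    define q where "q = star w * w * v"
    have "star q * q = star v * star w * (w * (star w * w) * v)"
      by (simp add: q_def star_mult star_star mult.assoc)
    also have "\<dots> = 0" using wAv[of "star w * w"] by (simp only: mult_zero_right)
    finally have "q = 0" by (rule star_mult_self_eq_0)
    then have "star (w * v) * (w * v) = 0"
      by (simp add: q_def star_mult mult.assoc)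
    then have "w * v = 0" by (rule star_mult_self_eq_0)
    then show ?thesis using wAv by (simp add: I_def)
  qed
  moreover have "v \<in> J" by (simp add: J_def I_def)
  moreover have "I \<noteq> UNIV"
  proof
    assume "I = UNIV"
    then have "star v * v = 0" by (auto simp: I_def)
    then show False using star_mult_self_eq_0 nz by blast
  qed
  moreover have "J \<noteq> UNIV"
  proof
    assume "J = UNIV"
    then have "w * star w = 0" using \<open>w \<in> I\<close> by (auto simp: J_def)
    then show False using mult_star_self_eq_0 nz by blast
  qed
  moreover have "w * v = 0"
    using \<open>w \<in> I\<close> by (simp add: I_def)
  then have "{a * b | a b. a \<in> I \<and> b \<in> J} = {0}"
    using \<open>w \<in> I\<close> \<open>v \<in> J\<close> by (force simp: J_def)
  ultimately show False
    using assms(1) I J nz unfolding cstar_factor_def by blast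
qed

text \<open>For \<open>w\<close> in \<open>W\<close> and \<open>v\<close> in \<open>zann S\<close>,
  each \<open>w * b * v\<close> lies in both dual sets: \<open>v\<close> kills \<open>W\<close> on
  its right, and \<open>zann S\<close> kills \<open>w\<close> from the left. Centrality gives w A v
  = 0, contradicting primeness.\<close>

lemma factor_central_ann:
  assumes "cstar_factor cscale" "central_ann star W"
  shows "W = {0} \<or> W = UNIV"
proof (rule ccontr)
  assume nontriv: "\<not> (W = {0} \<or> W = UNIV)"
  obtain S where S: "S \<subseteq> positive_part star" "W = Ann (Ann S)"
      "dual_set (Ann (Ann S)) \<inter> dual_set (Ann S) = {0}"
    using assms(2) by (auto simp: central_ann_def)
  have T: "Ann S = zann S" "W = zann (zann S)"
    using S by (simp_all add: Ann_positive Ann_zann star_closed_positive)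
  have "zann S \<noteq> {0}" using nontriv T by auto
  then obtain v where v: "v \<in> zann S" "v \<noteq> 0" using zero_in_zann by blast
  obtain w where w: "w \<in> W" "w \<noteq> 0" using nontriv T zero_in_zann[of "zann S"] by blast
  have "w * b * v = 0" for b
  proof -
    have vx: "v * x = 0" if "x \<in> W" for x
      using v(1) that by (auto simp: T zann_def)
    have xw: "x * w = 0" if "x \<in> zann S" for x
      using w(1) that by (auto simp: T zann_def)
    have "x * (w * b * v) * y + y * (w * b * v) * x = 0" if "x \<in> W" "y \<in> W" for x y
      using vx that by (simp add: mult.assoc)
    then have "w * b * v \<in> dual_set W" by (simp add: dual_set_def)
    moreover have "x * (w * b * v) * y + y * (w * b * v) * x = 0" if "x \<in> zann S" "y \<in> zann S" for x y
      using xw that by (simp flip: mult.assoc)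
    then have "w * b * v \<in> dual_set (zann S)" by (simp add: dual_set_def)
    ultimately show ?thesis
      using S T by auto
  qed
  then show False using factor_prime[OF assms(1)] v w by blast
qed

text \<open>Makes {0} its own central support, which later shows that the given Abelian annihilator
  is nonzero.\<close>

lemma central_ann_zero: "central_ann star {0}"
proof -
  have "a = 0" if "a \<in> dual_set (UNIV :: 'a set)" for a
  proof -
    have "star a * a * star a + star a * a * star a = 0"
      using that by (simp add: dual_set_def)
    then have "2 *\<^sub>R (star a * a * star a) = 0" by (simp add: scaleR_2)
    then have "star a * a * star a = 0" by simp
    then have "star (star a * a) * (star a * a) = 0"
      by (simp add: star_mult star_star) (simp flip: mult.assoc)
    then show "a = 0" by (blast dest: star_mult_self_eq_0)
  qed
  moreover have "0 \<in> dual_set X" for X :: "'a set" by (simp add: dual_set_def)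
  ultimately have "dual_set {0 :: 'a} \<inter> dual_set UNIV = {0}" by auto
  moreover have "Ann (UNIV :: 'a set) = {0}" "Ann {} = (UNIV :: 'a set)" "Ann {0} = (UNIV :: 'a set)"
    using Ann_zann[of "{0}"] by (simp_all add: star_closed_def Ann_def)
  ultimately show ?thesis
    unfolding central_ann_def
    by (intro exI[of _ "{0}"]) (auto simp: positive_part_def intro: exI[of _ 0])
qed

lemma ann_inf_eqI: "is_glb_in (annihilators star) X m \<Longrightarrow> ann_inf star X = m"
  unfolding ann_inf_def by (rule the_equality) (auto simp: is_glb_in_def)

lemma ann_sup_eqI: "is_lub_in (annihilators star) X m \<Longrightarrow> ann_sup star X = m"
  unfolding ann_sup_def by (rule the_equality) (auto simp: is_lub_in_def)

lemma central_support_zero: "central_support star {0} = {0}"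
  unfolding central_support_def
  by (rule ann_inf_eqI)
    (use zero_in_annihilators central_ann_zero in \<open>auto simp: is_glb_in_def\<close>)

text \<open>At most \<open>UNIV\<close> is a central annihilator containing \<open>V\<close>, and
  the infimum of such a family is \<open>UNIV\<close> even if it is empty.\<close>

lemma factor_central_support:
  assumes "cstar_factor cscale" "V \<in> annihilators star" "V \<noteq> {0}"
  shows "central_support star V = UNIV"
proof -
  have "V \<noteq> {}"
    using assms(2) zero_in_zann[of "zann V"] by (auto simp: annihilators_iff)
  then have "W = UNIV" if "central_ann star W" "V \<subseteq> W" for W
    using factor_central_ann[OF assms(1) that(1)] that(2) assms(3) by blast
  then show ?thesis
    unfolding central_support_def
    by (intro ann_inf_eqI) (auto simp: is_glb_in_def UNIV_in_annihilators)
qed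

lemma ann_sup_eq:
  assumes "X \<subseteq> annihilators star"
  shows "ann_sup star X = zann (zann (\<Union>X))"
proof (rule ann_sup_eqI)
  have "star_closed (\<Union>X)"
    using assms by (fastforce simp: annihilators_iff star_closed_def)
  then have "zann (zann (\<Union>X)) \<in> annihilators star"
    by (intro zann_in_annihilators star_closed_zann)
  moreover have "zann (zann (\<Union>X)) \<subseteq> U" if "U \<in> annihilators star" "\<forall>x\<in>X. x \<subseteq> U" for U
    using that zann_zann_mono[of "\<Union>X" U] by (auto simp: annihilators_iff)
  ultimately show "is_lub_in (annihilators star) X (zann (zann (\<Union>X)))"
    using subset_zann_zann[of "\<Union>X"] by (auto simp: is_lub_in_def)
qed

section \<open>Transfer of the Abelian property\<close>

text \<open>If \<open>t * z = 0\<close>, then \<open>z * star z\<close> annihilates \<open>t\<close>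
  on both sides, so it annihilates \<open>z\<close> as well, which forces \<open>z = 0\<close>. The
  other side follows by applying \<open>star\<close>.\<close>

lemma zann_zann_cancel:
  assumes t: "star t = t" and y: "y \<in> zann (zann {t})" and ty: "t * y = 0 \<or> y * t = 0"
  shows "y = 0"
proof -
  have cancel: "z = 0" if z: "z \<in> zann (zann {t})" and tz: "t * z = 0" for z
  proof -
    have "t * (z * star z) = 0" using tz by (simp flip: mult.assoc)
    moreover from this have "(z * star z) * t = 0"
      using t by (metis star_mult star_star star_zero)
    ultimately have "z * star z \<in> zann {t}" by (simp add: zann_def)
    then have "z * star z * z = 0" using z by (auto simp: zann_def)
    then have "star (z * star z) * (z * star z) = 0"
      by (simp add: star_mult star_star) (simp flip: mult.assoc)
    then have "z * star z = 0" by (rule star_mult_self_eq_0)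
    then show ?thesis by (rule mult_star_self_eq_0)
  qed
  show ?thesis
  proof (cases "t * y = 0")
    case False
    then have "t * star y = 0" using ty t by (metis star_mult star_zero)
    moreover have "star y \<in> zann (zann {t})"
      using star_closed_zann[OF star_closed_zann, of "{t}"] t y by (auto simp: star_closed_def)
    ultimately show ?thesis using cancel[of "star y"] by (metis star_star star_zero)
  qed (use y cancel in blast)
qed

lemma abelian_ann_transfer:
  assumes V: "abelian_ann star V" and x: "x = v * a" "v \<in> V"
  shows "abelian_ann star (zann (zann {star x * x}))"
proof -
  define t where "t = star x * x"
  let ?W = "zann (zann {t})"
  have t: "star t = t" by (simp add: t_def star_mult star_star)
  have V': "star_closed V" "zann (zann V) = V" "abelian_set V"
    using V by (auto simp: abelian_ann_def annihilators_iff)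
  have W: "?W \<in> annihilators star"
    using t by (intro zann_in_annihilators star_closed_zann) (simp add: star_closed_def)
  have tW: "t \<in> ?W" using subset_zann_zann by blast
  have xV: "x * p * star x \<in> V" for p
  proof -
    have "v * (a * p * star a) * star v \<in> zann (zann V)"
      using V' x(2) by (intro zann_hereditary) (auto simp: star_closed_def)
    then show ?thesis using V'(2) by (simp add: x(1) star_mult mult.assoc)
  qed
  \<comment> \<open>Commutation of \<open>x * p * star x\<close> and \<open>x * q * star x\<close>,
    multiplied by \<open>star x\<close> on the left and \<open>x\<close> on the right.\<close>
  have key: "t * (p * t * q - q * t * p) * t = 0" for p q
  proof -
    have "(x * p * star x) * (x * q * star x) = (x * q * star x) * (x * p * star x)"
      using V'(3) xV by (auto simp: abelian_set_def)
    then have "star x * ((x * p * star x) * (x * q * star x)) * x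
        = star x * ((x * q * star x) * (x * p * star x)) * x"
      by simp
    then show ?thesis by (simp add: t_def algebra_simps)
  qed
  have cancel: "y = 0" if "y \<in> ?W" "t * y = 0 \<or> y * t = 0" for y
    using zann_zann_cancel[OF t that] .
  have ptq: "p * t * q = q * t * p" if "p \<in> ?W" "q \<in> ?W" for p q
  proof -
    have d: "p * t * q - q * t * p \<in> ?W"
      using that by (intro zann_diff zann_hereditary)
    then have "t * (p * t * q - q * t * p) = 0"
      using key tW by (intro cancel zann_mult) auto
    then show ?thesis using cancel[OF d] by simp
  qed
  \<comment> \<open>Taking \<open>q = t\<close> and \<open>q = t * t\<close> in \<open>ptq\<close>
    shows that \<open>p\<close> commutes with the square and the cube of \<open>t\<close>; hence t
    (t p - p t) t = 0, and \<open>t\<close> is cancelled on both sides.\<close>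
  have comm_t: "t * p = p * t" if p: "p \<in> ?W" for p
  proof -
    have "(t * p - p * t) * t = 0"
    proof (rule cancel)
      show "(t * p - p * t) * t \<in> ?W" using p tW by (intro zann_mult zann_diff)
      have 1: "p * t * t = t * t * p" and 2: "p * t * (t * t) = t * t * t * p"
        using ptq[OF p tW] ptq[OF p zann_mult[OF tW tW]] by simp_all
      have "t * ((t * p - p * t) * t) = (t * t * p) * t - t * (p * t * t)"
        by (simp add: algebra_simps)
      also have "\<dots> = 0"
        by (metis 1 2 mult.assoc diff_self)
      finally show "t * ((t * p - p * t) * t) = 0 \<or> (t * p - p * t) * t * t = 0" ..
    qed
    then show ?thesis using cancel[of "t * p - p * t"] p tW by (simp add: zann_diff zann_mult)
  qed
  have "p * q = q * p" if "p \<in> ?W" "q \<in> ?W" for p q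
  proof -
    have "t * (p * q - q * p) = 0"
      using ptq[OF that] comm_t[OF that(1)] comm_t[OF that(2)]
      by (simp add: right_diff_distrib) (simp flip: mult.assoc)
    then show ?thesis using cancel[of "p * q - q * p"] that by (simp add: zann_diff zann_mult)
  qed
  then show ?thesis using W by (auto simp: abelian_ann_def abelian_set_def t_def)
qed

section \<open>Maximal orthogonal families of Abelian annihilators\<close>

text \<open>
  If the sum of a maximal orthogonal family were not everything, its complement would contain some
  \<open>x\<^sup>* x \<noteq> 0\<close> with \<open>x = v b w\<close> and \<open>v\<close> in the given Abelian annihilator, and the annihilator
  generated by \<open>x\<^sup>* x\<close> would enlarge the family.
\<close>
lemma factor_type_I_family:
  assumes factor: "cstar_factor cscale" and "vN_type_I star"
  shows "\<exists>X. type_I_family star X (\<lambda>V. V)"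
proof -
  obtain V where V: "abelian_ann star V" "central_support star V = UNIV"
    using assms(2) by (auto simp: vN_type_I_def)
  \<comment> \<open>Excluding {0} ensures that every member has central support
    \<open>UNIV\<close>.\<close>
  define F where "F = {X. X \<subseteq> {U. abelian_ann star U \<and> U \<noteq> {0}} \<and> pairwise orthogonal_sets X}"
  have "\<exists>M\<in>F. \<forall>X\<in>F. M \<subseteq> X \<longrightarrow> X = M"
  proof (rule subset_Zorn_nonempty)
    show "F \<noteq> {}" by (auto simp: F_def pairwise_def)
    fix C assume C: "C \<noteq> {}" "subset.chain F C"
    have "pairwise orthogonal_sets (\<Union>C)"
      unfolding pairwise_def
    proof (intro ballI impI)
      fix U W assume UW: "U \<in> \<Union>C" "W \<in> \<Union>C" "U \<noteq> W"
      then obtain X1 X2 where "X1 \<in> C" "U \<in> X1" "X2 \<in> C" "W \<in> X2" by blast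
      moreover from this have "X1 \<subseteq> X2 \<or> X2 \<subseteq> X1"
        using C(2) unfolding subset_chain_def by blast
      ultimately obtain X where "X \<in> C" "U \<in> X" "W \<in> X" by blast
      moreover have "pairwise orthogonal_sets X"
        using C(2) \<open>X \<in> C\<close> unfolding subset_chain_def F_def by blast
      ultimately show "orthogonal_sets U W"
        using UW(3) unfolding pairwise_def by blast
    qed
    moreover have "\<Union>C \<subseteq> {U. abelian_ann star U \<and> U \<noteq> {0}}"
      using C(2) unfolding F_def subset_chain_def by blast
    ultimately show "\<Union>C \<in> F" unfolding F_def by blast
  qed
  then obtain X where X: "X \<in> F" and max: "\<And>Y. Y \<in> F \<Longrightarrow> X \<subseteq> Y \<Longrightarrow> Y = X"
    by blast
  have abelian: "abelian_ann star U" "U \<noteq> {0}" if "U \<in> X" for U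
    using X that by (auto simp: F_def)
  have ann: "X \<subseteq> annihilators star"
    using abelian by (auto simp: abelian_ann_def)
  have sc: "star_closed (\<Union>X)"
    using ann by (fastforce simp: annihilators_iff star_closed_def)
  define Y where "Y = zann (\<Union>X)"
  have scY: "star_closed Y" unfolding Y_def using sc by (rule star_closed_zann)
  have "Y = {0}"
  proof (rule ccontr)
    assume "Y \<noteq> {0}"
    then obtain w where w: "w \<in> Y" "w \<noteq> 0"
      using zero_in_zann[of "\<Union>X"] by (auto simp: Y_def)
    have "V \<noteq> {0}"
      using V(2) w(2) central_support_zero UNIV_I[of w] by (metis singletonD)
    moreover have "0 \<in> V"
      using V(1) zero_in_zann[of "zann V"] by (simp add: abelian_ann_def annihilators_iff)
    ultimately obtain v where v: "v \<in> V" "v \<noteq> 0" by blast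
    obtain b where b: "v * b * w \<noteq> 0"
      using factor_prime[OF factor, of v w] v(2) w(2) by metis
    define x where "x = v * b * w"
    define U where "U = zann (zann {star x * x})"
    have tU: "star x * x \<in> U" unfolding U_def using subset_zann_zann by blast
    have t0: "star x * x \<noteq> 0" using b star_mult_self_eq_0[of x] unfolding x_def by blast
    have U: "abelian_ann star U"
      unfolding U_def by (rule abelian_ann_transfer[OF V(1) _ v(1)]) (simp add: x_def mult.assoc)
    have "star w * (star b * star v * v * b) * w \<in> Y"
      using scY w(1) unfolding Y_def by (intro zann_hereditary) (auto simp: star_closed_def)
    then have "star x * x \<in> Y" by (simp add: x_def star_mult mult.assoc)
    then have "U \<subseteq> Y"
      using zann_zann_mono[of "{star x * x}" Y] by (simp add: U_def Y_def)
    then have "y \<in> zann (\<Union>X)" if "y \<in> U" for y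
      using that by (auto simp: Y_def)
    then have orth: "orthogonal_sets U W \<and> orthogonal_sets W U" if "W \<in> X" for W
      using that unfolding orthogonal_sets_def zann_def by blast
    have "U \<noteq> {0}" using tU t0 by blast
    moreover have "pairwise orthogonal_sets (insert U X)"
      using X orth by (simp add: pairwise_insert F_def)
    ultimately have "insert U X \<in> F"
      using X U by (simp add: F_def)
    then have "U \<in> X" using max by blast
    \<comment> \<open>As a member of \<open>X\<close>, \<open>U\<close> would be orthogonal to
      itself.\<close>
    then have "(star x * x) * (star x * x) = 0"
      using orth tU unfolding orthogonal_sets_def by blast
    then have "star (star x * x) * (star x * x) = 0" by (simp add: star_mult star_star)
    then show False using star_mult_self_eq_0[of "star x * x"] t0 by blast
  qed
  then have "ann_sup star X = UNIV"
    using ann_sup_eq[OF ann] unfolding Y_def by simp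
  moreover have "central_support star U = UNIV" if "U \<in> X" for U
    using that ann abelian by (intro factor_central_support[OF factor]) auto
  \<comment> \<open>The family is indexed by its own members, so n is the cardinality of
    \<open>X\<close>.\<close>
  ultimately have "type_I_family star X (\<lambda>V. V)"
    using X abelian by (auto simp: type_I_family_def F_def pairwise_def)
  then show ?thesis ..
qed

end

theorem theorem25:
  fixes cscale :: "complex \<Rightarrow> 'a::{real_normed_algebra, banach} \<Rightarrow> 'a"
    and star :: "'a \<Rightarrow> 'a"
  assumes "cstar_algebra cscale star"
    and "cstar_factor cscale"
    and "vN_type_I star"
  shows "\<exists>(Xi :: 'a set set) (P :: 'a set \<Rightarrow> 'a set). type_I_family star Xi P"
  using cstar_algebra.factor_type_I_family[OF assms] by blast

end
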